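(* Let $p$ be a prime and let $S=\{(a,b)\in\mathbb{F}_p^2 \mid b<a\}$, where elements of $\mathbb{F}_p$ are identified with the integers $0,1,\ldots,p-1$ for the purpose of the comparison $b<a$. Let $T\subseteq\mathbb{F}_p^2$ be a set which is equidistributed in exactly $p-2$ directions. If $|T|=\frac{p(p-1)}{2}$, then $T=\alpha(S)$ for some $\alpha\in AGL(2,p)$; and if $|T|=\frac{p(p+1)}{2}$, then $T=\alpha'(S^c)$ for some $\alpha'\in AGL(2,p)$, where $S^c=\mathbb{F}_p^2\setminus S$ is the complement of $S$.
   Context: $\mathbb{F}_p$ is the field with $p$ elements. A direction is an equivalence class of nonzero vectors of $\mathbb{F}_p^2$ under multiplication by nonzero scalars; there are $p+1$ directions, and each corresponds to a class of $p$ parallel affine lines. A set $T\subseteq\mathbb{F}_p^2$ is equidistributed in a direction if all $p$ lines parallel to that direction intersect $T$ in the same number of points. $AGL(2,p)$ is the group of invertible affine transformations of $\mathbb{F}_p^2$. *)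

theory Defs
  imports "HOL-Analysis.Cartesian_Space" "Berlekamp_Zassenhaus.Finite_Field"
begin

text \<open>
  For \<open>'p :: prime_card\<close>, the type \<open>'p mod_ring\<close> is the prime field with \<open>p = CARD('p)\<close>
  elements, and \<open>to_int_mod_ring\<close> sends an element to its representative in \<open>{0..<p}\<close>.
\<close>

type_synonym 'p plane = "'p mod_ring ^ 2"

definition proportional :: "('p::prime_card plane \<times> 'p plane) set" where
  "proportional = {(u, v). u \<noteq> 0 \<and> v \<noteq> 0 \<and> (\<exists>c. c \<noteq> 0 \<and> v = c *s u)}"

definition directions :: "'p::prime_card plane set set" where
  "directions = {v. v \<noteq> 0} // proportional"

definition affine_line :: "'p::prime_card plane \<Rightarrow> 'p plane \<Rightarrow> 'p plane set" where
  "affine_line x v = {x + t *s v | t. True}"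

definition lines_in_direction :: "'p::prime_card plane set \<Rightarrow> 'p plane set set" where
  "lines_in_direction D = {affine_line x v | x v. v \<in> D}"

definition equidistributed :: "'p::prime_card plane set \<Rightarrow> 'p plane set \<Rightarrow> bool" where
  "equidistributed T D \<longleftrightarrow> (\<exists>k. \<forall>l \<in> lines_in_direction D. card (l \<inter> T) = k)"

definition AGL2 :: "('p::prime_card plane \<Rightarrow> 'p plane) set" where
  "AGL2 = {\<lambda>x. A *v x + b | A b. invertible A}"

definition S_set :: "'p::prime_card plane set" where
  "S_set = {x. to_int_mod_ring (x $ 2) < to_int_mod_ring (x $ 1)}"

end

theory Submission
  imports Defs "HOL-Analysis.Determinants"
begin

text \<open>
  Summing the sizes of \<open>l \<inter> T\<close> over the \<open>p + 1\<close> lines \<open>l\<close> through a point \<open>q\<close> counts every point of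
  \<open>T\<close> once, and \<open>q\<close> itself \<open>p\<close> further times if it lies in \<open>T\<close>. Equidistributed directions
  contribute \<open>|T| / p\<close> each, so when \<open>|T| = p (p - 1) / 2\<close> the line counts \<open>A, B, C\<close> in the three
  remaining directions satisfy \<open>A x + B y + C (x + y) = p - 1 + p [q \<in> T]\<close> in suitable coordinates
  \<open>x, y\<close> of \<open>q\<close>. Modulo \<open>p\<close> this is a Cauchy--Pexider equation, so \<open>A, B, C\<close> are affine modulo
  \<open>p\<close> with slopes \<open>d, d, - d\<close>. If \<open>d = 0\<close>, then the non-constant counts take only the values \<open>0\<close> and
  \<open>p\<close>, contradicting \<open>A + B + C = - 1\<close> modulo \<open>p\<close>. If \<open>d \<noteq> 0\<close>, the total \<open>p (p - 1) / 2\<close> forces every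
  count to be the least residue of its class. Then \<open>q \<in> T\<close> says exactly that adding the
  representatives of \<open>X = a + d x\<close> and \<open>Y = b + d y\<close> produces a carry, that is, \<open>X + Y < X\<close>.
  The case \<open>|T| = p (p + 1) / 2\<close> follows by passing to the complement.
\<close>

section \<open>The determinant form and its level sets\<close>

definition det2 :: "'a::comm_ring_1 ^ 2 \<Rightarrow> 'a ^ 2 \<Rightarrow> 'a" where
  "det2 u q = u $ 1 * q $ 2 - u $ 2 * q $ 1"

text \<open>For \<open>v\<close> nonzero, the lines parallel to \<open>v\<close> are the level sets
  of \<open>det2 v\<close>, so the field elements \<open>s\<close> index the whole parallel
  class.\<close>

definition line_count :: "'p::prime_card plane set \<Rightarrow> 'p plane \<Rightarrow> 'p mod_ring \<Rightarrow> nat" where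
  "line_count T v s = card {q \<in> T. det2 v q = s}"

lemma vec2_eq_iff: "(x :: 'a ^ 2) = y \<longleftrightarrow> x $ 1 = y $ 1 \<and> x $ 2 = y $ 2"
  by (simp add: vec_eq_iff forall_2)

lemma det2_diff_right: "det2 v (x - y) = det2 v x - det2 v y"
  by (simp add: det2_def algebra_simps)

lemma det2_add_left: "det2 (u + v) x = det2 u x + det2 v x"
  by (simp add: det2_def algebra_simps)

lemma det2_scale_left: "det2 (c *s u) x = c * det2 u x"
  by (simp add: det2_def algebra_simps)

lemma det2_scale_right: "det2 u (c *s x) = c * det2 u x"
  by (simp add: det2_def algebra_simps)

lemma det2_self: "det2 u u = 0"
  by (simp add: det2_def)

lemma det2_swap: "det2 v u = - det2 u v"
  by (simp add: det2_def)

text \<open>Cramer's rule without division. It later supplies the scalars that turn representatives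
  of three distinct directions into vectors \<open>u\<close>, \<open>v\<close>,
  \<open>u + v\<close>.\<close>

lemma det2_cramer: "det2 u v *s w = (- det2 v w) *s u + det2 u w *s v"
  by (simp add: vec2_eq_iff det2_def algebra_simps)

lemma det2_eq_0_iff:
  fixes u :: "'a::field ^ 2"
  assumes "u \<noteq> 0"
  shows "det2 u x = 0 \<longleftrightarrow> (\<exists>c. x = c *s u)"
proof
  assume *: "det2 u x = 0"
  show "\<exists>c. x = c *s u"
  proof (cases "u $ 1 = 0")
    case True
    then have "u $ 2 \<noteq> 0" using assms by (simp add: vec2_eq_iff)
    then have "x = (x $ 2 / u $ 2) *s u" using * True by (simp add: vec2_eq_iff det2_def)
    then show ?thesis by blast
  next
    case False
    then have "x = (x $ 1 / u $ 1) *s u"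
      using * by (simp add: vec2_eq_iff det2_def field_simps)
    then show ?thesis by blast
  qed
qed (auto simp: det2_def)

lemma det2_surj:
  fixes v :: "'a::field ^ 2"
  assumes "v \<noteq> 0"
  shows "\<exists>x. det2 v x = s"
proof -
  from assms obtain y where y: "det2 v y \<noteq> 0"
  proof (cases "v $ 1 = 0")
    case True
    then show ?thesis using assms that[of "vector [1, 0]"] by (auto simp: det2_def vec2_eq_iff)
  next
    case False
    then show ?thesis using that[of "vector [0, 1]"] by (auto simp: det2_def)
  qed
  then have "det2 v ((s / det2 v y) *s y) = s" by (simp add: det2_scale_right)
  then show ?thesis by blast
qed

lemma affine_line_eq:
  assumes "v \<noteq> 0"
  shows "affine_line x v = {y. det2 v y = det2 v x}"
proof -
  have "y \<in> affine_line x v \<longleftrightarrow> det2 v y = det2 v x" for y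
  proof -
    have "y \<in> affine_line x v \<longleftrightarrow> (\<exists>c. y - x = c *s v)"
      by (auto simp: affine_line_def algebra_simps)
    also have "\<dots> \<longleftrightarrow> det2 v (y - x) = 0" using det2_eq_0_iff[OF assms] by auto
    also have "\<dots> \<longleftrightarrow> det2 v y = det2 v x" by (auto simp: det2_def algebra_simps)
    finally show ?thesis .
  qed
  then show ?thesis by blast
qed

section \<open>Directions as proportionality classes\<close>

lemma equiv_proportional: "equiv {v. v \<noteq> 0} (proportional :: ('p::prime_card plane \<times> 'p plane) set)"
proof (intro equivI refl_onI symI transI)
  fix x :: "'p plane" assume "x \<in> {v. v \<noteq> 0}"
  then show "(x, x) \<in> proportional" by (auto simp: proportional_def intro!: exI[of _ 1])
next
  fix x y :: "'p plane" assume "(x, y) \<in> proportional"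
  then obtain c where "x \<noteq> 0" "y \<noteq> 0" "c \<noteq> 0" "y = c *s x" by (auto simp: proportional_def)
  then show "(y, x) \<in> proportional"
    by (auto simp: proportional_def vector_smult_assoc intro!: exI[of _ "inverse c"])
next
  fix x y z :: "'p plane" assume "(x, y) \<in> proportional" "(y, z) \<in> proportional"
  then obtain c d where "x \<noteq> 0" "c \<noteq> 0" "y = c *s x" "z \<noteq> 0" "d \<noteq> 0" "z = d *s y"
    by (auto simp: proportional_def)
  then show "(x, z) \<in> proportional"
    by (auto simp: proportional_def vector_smult_assoc intro!: exI[of _ "d * c"])
qed (auto simp: proportional_def)

lemma mem_proportional_class:
  assumes "v \<noteq> 0"
  shows "x \<in> proportional `` {v} \<longleftrightarrow> (\<exists>c. c \<noteq> 0 \<and> x = c *s v)"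
  using assms by (auto simp: proportional_def vec_eq_iff)

lemma card_proportional_class:
  fixes v :: "'p::prime_card plane"
  assumes "v \<noteq> 0"
  shows "card (proportional `` {v}) = CARD('p) - 1"
proof -
  have "proportional `` {v} = (\<lambda>c. c *s v) ` (UNIV - {0})"
    using mem_proportional_class[OF assms] by auto
  moreover have "inj (\<lambda>c. c *s v)"
    using assms by (auto simp: inj_def vec_eq_iff)
  then have "inj_on (\<lambda>c. c *s v) (UNIV - {0})" by (rule inj_on_subset) auto
  ultimately show ?thesis by (simp add: card_image card_Diff_subset)
qed

text \<open>The classes, each of size \<open>p - 1\<close>, partition the \<open>p^2 - 1\<close>
  nonzero vectors.\<close>

lemma card_directions: "card (directions :: 'p::prime_card plane set set) = CARD('p) + 1"
proof -
  let ?D = "directions :: 'p plane set set"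
  have p: "CARD('p) > 1" by (rule nontriv)
  have U: "\<Union>?D = {v. v \<noteq> 0}"
    unfolding directions_def by (rule Union_quotient[OF equiv_proportional])
  have "(CARD('p) - 1) * card ?D = card (\<Union>?D)"
  proof (rule card_partition)
    show "card D = CARD('p) - 1" if "D \<in> ?D" for D
      using that card_proportional_class by (auto simp: directions_def elim!: quotientE)
    show "D \<inter> D' = {}" if "D \<in> ?D" "D' \<in> ?D" "D \<noteq> D'" for D D'
      using quotient_disj[OF equiv_proportional] that unfolding directions_def by blast
  qed auto
  also have "{v :: 'p plane. v \<noteq> 0} = UNIV - {0}" by auto
  then have "card (\<Union>?D) = CARD('p)^2 - 1"
    unfolding U by (simp add: card_Diff_subset)
  also have "\<dots> = (CARD('p) - 1) * (CARD('p) + 1)"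
    by (simp add: algebra_simps power2_eq_square)
  finally have "(CARD('p) - 1) * card ?D = (CARD('p) - 1) * (CARD('p) + 1)" .
  then show ?thesis using p by (subst (asm) mult_cancel1) simp
qed

section \<open>Equidistribution and counting along the lines through a point\<close>

lemma sum_line_count: "(\<Sum>s\<in>UNIV. line_count T v s) = card T"
  using sum.group[of T "UNIV" "det2 v" "\<lambda>_. 1::nat"] by (simp add: line_count_def)

text \<open>Rescaling the representative \<open>v\<close> only relabels the level sets of
  \<open>det2 v\<close>, so one representative sees all lines of the direction.\<close>

lemma equidistributed_iff:
  assumes "v \<noteq> 0"
  shows "equidistributed T (proportional `` {v}) \<longleftrightarrow> (\<exists>k. \<forall>s. line_count T v s = k)"
proof -
  have "lines_in_direction (proportional `` {v}) = (\<lambda>s. {y. det2 v y = s}) ` UNIV"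
  proof (intro equalityI subsetI)
    fix l assume "l \<in> lines_in_direction (proportional `` {v})"
    then obtain x c where "c \<noteq> 0" "l = affine_line x (c *s v)"
      using mem_proportional_class[OF assms] by (auto simp: lines_in_direction_def)
    moreover from this have "c *s v \<noteq> 0" using assms by (auto simp: vec_eq_iff)
    ultimately show "l \<in> (\<lambda>s. {y. det2 v y = s}) ` UNIV"
      by (auto simp: affine_line_eq det2_scale_left)
  next
    fix l assume "l \<in> (\<lambda>s. {y. det2 v y = s}) ` UNIV"
    then obtain s where "l = {y. det2 v y = s}" by auto
    moreover obtain x where "det2 v x = s" using det2_surj[OF assms] by blast
    ultimately have "l = affine_line x v" using affine_line_eq[OF assms] by simp
    moreover have "v \<in> proportional `` {v}"
      using mem_proportional_class[OF assms] by (auto intro!: exI[of _ 1])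
    ultimately show "l \<in> lines_in_direction (proportional `` {v})"
      by (auto simp: lines_in_direction_def)
  qed
  moreover have "{y. det2 v y = s} \<inter> T = {y \<in> T. det2 v y = s}" for s by auto
  ultimately show ?thesis by (simp add: equidistributed_def line_count_def)
qed

text \<open>Stated on the class \<open>D\<close>, so that it can be summed over directions without
  choosing representatives. Classes omit the zero vector, hence the separate case
  \<open>x = q\<close>.\<close>

definition count_through :: "'p::prime_card plane set \<Rightarrow> 'p plane \<Rightarrow> 'p plane set \<Rightarrow> nat" where
  "count_through T q D = card {x \<in> T. x = q \<or> x - q \<in> D}"

lemma count_through_class:
  assumes "v \<noteq> 0"
  shows "count_through T q (proportional `` {v}) = line_count T v (det2 v q)"
proof -
  have "x = q \<or> x - q \<in> proportional `` {v} \<longleftrightarrow> det2 v x = det2 v q" for x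
  proof -
    have "x = q \<or> x - q \<in> proportional `` {v} \<longleftrightarrow> (\<exists>c. x - q = c *s v)"
      unfolding mem_proportional_class[OF assms] by (metis right_minus_eq vector_smult_lzero)
    also have "\<dots> \<longleftrightarrow> det2 v (x - q) = 0" using det2_eq_0_iff[OF assms] by auto
    also have "\<dots> \<longleftrightarrow> det2 v x = det2 v q" by (auto simp: det2_def algebra_simps)
    finally show ?thesis .
  qed
  then show ?thesis by (simp add: count_through_def line_count_def)
qed

text \<open>The classes cut \<open>T - {q}\<close> into disjoint pieces. If \<open>q\<close> lies in
  \<open>T\<close>, it is counted \<open>p + 1\<close> times, and one of these completes
  \<open>card T\<close>.\<close>

lemma sum_count_through:
  fixes T :: "'p::prime_card plane set"
  shows "(\<Sum>D\<in>directions. count_through T q D) = card T + CARD('p) * of_bool (q \<in> T)"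
proof -
  let ?D = "directions :: 'p plane set set"
  let ?A = "\<lambda>D. {x \<in> T. x - q \<in> D}"
  have U: "\<Union>?D = {v. v \<noteq> 0}"
    unfolding directions_def by (rule Union_quotient[OF equiv_proportional])
  have ct: "count_through T q D = card (?A D) + of_bool (q \<in> T)" if "D \<in> ?D" for D
  proof -
    have "{x \<in> T. x = q \<or> x - q \<in> D} = ?A D \<union> (if q \<in> T then {q} else {})" by auto
    moreover have "q \<notin> ?A D" using U that by auto
    ultimately show ?thesis by (simp add: count_through_def)
  qed
  have "card (\<Union>(?A ` ?D)) = (\<Sum>D\<in>?D. card (?A D))"
  proof (rule card_UN_disjoint)
    show "\<forall>D\<in>?D. \<forall>D'\<in>?D. D \<noteq> D' \<longrightarrow> ?A D \<inter> ?A D' = {}"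
      using quotient_disj[OF equiv_proportional] unfolding directions_def by blast
  qed auto
  moreover have "\<Union>(?A ` ?D) = T - {q}"
  proof -
    have "x \<in> \<Union>(?A ` ?D) \<longleftrightarrow> x \<in> T \<and> x - q \<in> \<Union>?D" for x by blast
    then show ?thesis unfolding U by auto
  qed
  ultimately have "(\<Sum>D\<in>?D. card (?A D)) = card (T - {q})" by simp
  moreover have "card (T - {q}) + of_bool (q \<in> T) = card T"
    by (cases "q \<in> T") (simp_all add: card_Suc_Diff1 del: card_Diff_insert card_Diff_singleton)
  moreover have "(\<Sum>D\<in>?D. count_through T q D)
      = (\<Sum>D\<in>?D. card (?A D)) + (CARD('p) + 1) * of_bool (q \<in> T)"
    using ct by (simp add: sum.distrib card_directions)
  ultimately show ?thesis by (simp add: algebra_simps)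
qed

section \<open>Least residues in the prime field\<close>

lemma to_int_mod_ring_bounds:
  "0 \<le> to_int_mod_ring (x :: 'p::prime_card mod_ring)" "to_int_mod_ring x < int CARD('p)"
  using range_to_int_mod_ring[where 'a='p] by (metis atLeastLessThan_iff rangeI)+

lemma of_int_to_int_mod_ring [simp]:
  "of_int (to_int_mod_ring (x :: 'p::prime_card mod_ring)) = x"
  by (simp add: of_int_of_int_mod_ring)

lemma to_int_mod_ring_of_int:
  "to_int_mod_ring (of_int n :: 'p::prime_card mod_ring) = n mod int CARD('p)"
  unfolding of_int_of_int_mod_ring by transfer simp

lemma to_int_mod_ring_of_nat:
  "to_int_mod_ring (of_nat n :: 'p::prime_card mod_ring) = int (n mod CARD('p))"
  using to_int_mod_ring_of_int[of "int n", where 'p='p] by (simp add: zmod_int)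

lemma to_int_mod_ring_minus_1_minus:
  fixes x :: "'p::prime_card mod_ring"
  shows "to_int_mod_ring (- 1 - x) = int CARD('p) - 1 - to_int_mod_ring x"
proof -
  have "of_int (int CARD('p) - 1 - to_int_mod_ring x) = - 1 - x" by simp
  then show ?thesis
    using to_int_mod_ring_of_int[of "int CARD('p) - 1 - to_int_mod_ring x", where 'p='p]
      to_int_mod_ring_bounds[of x] by simp
qed

text \<open>The reflection \<open>x\<close> to \<open>- 1 - x\<close> reverses
  \<open>0, ..., p - 1\<close>, so paired representatives add up to \<open>p - 1\<close>.\<close>

lemma sum_to_int_mod_ring:
  "2 * (\<Sum>x\<in>UNIV. to_int_mod_ring (x :: 'p::prime_card mod_ring)) = int CARD('p) * (int CARD('p) - 1)"
proof -
  let ?r = "to_int_mod_ring :: 'p mod_ring \<Rightarrow> int"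
  have "bij_betw (\<lambda>x. - 1 - x) UNIV (UNIV :: 'p mod_ring set)"
    by (rule bij_betw_byWitness[where f'="\<lambda>x. - 1 - x"]) auto
  from sum.reindex_bij_betw[OF this, of ?r]
  have "(\<Sum>x\<in>UNIV. ?r x) = (\<Sum>x\<in>UNIV. int CARD('p) - 1 - ?r x)"
    by (simp add: to_int_mod_ring_minus_1_minus)
  then show ?thesis by (simp add: sum_subtractf)
qed

text \<open>Each \<open>N s\<close> is at least the least residue of its class. As \<open>d\<close>
  is nonzero, \<open>a + d * s\<close> runs through all classes, so these residues already sum to
  \<open>p (p - 1) / 2\<close>. Equal sums force termwise equality.\<close>

lemma affine_mod_counts_eq:
  fixes N :: "'p::prime_card mod_ring \<Rightarrow> nat"
  assumes N: "\<And>s. of_nat (N s) = a + d * s" and "d \<noteq> 0"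
    and sum: "2 * (\<Sum>s\<in>UNIV. N s) = CARD('p) * (CARD('p) - 1)"
  shows "int (N s) = to_int_mod_ring (a + d * s)"
proof -
  let ?r = "\<lambda>s. to_int_mod_ring (a + d * s)"
  have le: "?r s \<le> int (N s)" for s
    using to_int_mod_ring_of_nat[of "N s", where 'p='p] by (simp add: N)
  have "bij_betw (\<lambda>s. a + d * s) UNIV (UNIV :: 'p mod_ring set)"
    using \<open>d \<noteq> 0\<close> by (intro bij_betw_byWitness[where f'="\<lambda>s. (s - a) / d"]) auto
  from sum.reindex_bij_betw[OF this, of to_int_mod_ring]
  have "2 * (\<Sum>s\<in>UNIV. ?r s) = int CARD('p) * (int CARD('p) - 1)"
    by (simp add: sum_to_int_mod_ring)
  also have "\<dots> = int (2 * (\<Sum>s\<in>UNIV. N s))"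
    unfolding sum by (simp add: of_nat_diff Suc_leI)
  finally have "(\<Sum>s\<in>UNIV. ?r s) = (\<Sum>s\<in>UNIV. int (N s))" by simp
  from sum_mono_inv[OF this le, of s] show ?thesis by simp
qed

section \<open>Line counts of complements\<close>

lemma line_count_UNIV:
  fixes v :: "'p::prime_card plane"
  assumes "v \<noteq> 0"
  shows "line_count UNIV v s = CARD('p)"
proof -
  obtain x where "det2 v x = s" using det2_surj[OF assms] by blast
  then have "{q \<in> UNIV. det2 v q = s} = affine_line x v" using affine_line_eq[OF assms] by auto
  also have "\<dots> = (\<lambda>t. x + t *s v) ` UNIV" by (auto simp: affine_line_def)
  finally have "line_count UNIV v s = card ((\<lambda>t. x + t *s v) ` UNIV)"
    by (simp add: line_count_def)
  also have "\<dots> = CARD('p mod_ring)"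
    using assms by (intro card_image) (auto simp: inj_def vec_eq_iff)
  finally show ?thesis by simp
qed

lemma line_count_Compl:
  fixes v :: "'p::prime_card plane"
  assumes "v \<noteq> 0"
  shows "line_count T v s + line_count (- T) v s = CARD('p)"
proof -
  have "line_count T v s + line_count (- T) v s
      = card ({q \<in> T. det2 v q = s} \<union> {q \<in> - T. det2 v q = s})"
    unfolding line_count_def by (rule card_Un_disjoint[symmetric]) auto
  also have "{q \<in> T. det2 v q = s} \<union> {q \<in> - T. det2 v q = s} = {q \<in> UNIV. det2 v q = s}"
    by auto
  finally show ?thesis using line_count_UNIV[OF assms, of s] by (simp add: line_count_def)
qed

lemma line_count_le:
  fixes v :: "'p::prime_card plane"
  assumes "v \<noteq> 0"
  shows "line_count T v s \<le> CARD('p)"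
  using line_count_Compl[OF assms, of T s] by simp

lemma equidistributed_Compl:
  fixes T :: "'p::prime_card plane set"
  assumes "D \<in> directions" "equidistributed T D"
  shows "equidistributed (- T) D"
proof -
  obtain v where v: "v \<noteq> 0" "D = proportional `` {v}"
    using assms(1) by (auto simp: directions_def elim!: quotientE)
  obtain k where k: "line_count T v s = k" for s
    using assms(2) equidistributed_iff[OF v(1)] v(2) by blast
  have "line_count (- T) v s = CARD('p) - k" for s
    using line_count_Compl[OF v(1), of T s] k[of s] by simp
  then show ?thesis using equidistributed_iff[OF v(1)] v(2) by blast
qed

section \<open>Constant residues and the Cauchy-Pexider equation\<close>

lemma constant_mod_counts_eq_0:
  fixes N :: "'p::prime_card mod_ring \<Rightarrow> nat" and a :: "'p mod_ring"
  assumes N: "\<And>s. of_nat (N s) = a" and le: "\<And>s. N s \<le> CARD('p)"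
    and nonconst: "\<nexists>k. \<forall>s. N s = k"
  shows "a = 0"
proof (rule ccontr)
  assume a: "a \<noteq> 0"
  have "N s = nat (to_int_mod_ring a)" for s
  proof -
    \<comment> \<open>Among \<open>0, ..., p\<close> only the class of 0 has two members, 0 and
      \<open>p\<close>; a nonzero class determines the count.\<close>
    have "N s \<noteq> CARD('p)" using N[of s] a by auto
    then have "N s < CARD('p)" using le[of s] by simp
    then show ?thesis using to_int_mod_ring_of_nat[of "N s", where 'p='p] by (simp add: N)
  qed
  with nonconst show False by blast
qed

text \<open>Every element of the prime field is a multiple \<open>of_nat n\<close> of 1, so
  additivity alone gives linearity.\<close>

lemma additive_mod_ring:
  fixes h :: "'p::prime_card mod_ring \<Rightarrow> 'p mod_ring"
  assumes "\<And>x y. h (x + y) = h x + h y"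
  shows "h x = h 1 * x"
proof -
  have h0: "h 0 = 0" using assms[of 0 0] by (metis add_cancel_right_right add_0)
  have "h (of_nat n) = h 1 * of_nat n" for n
    by (induction n) (simp_all add: h0 assms algebra_simps)
  then show ?thesis using surj_of_nat_mod_ring[of x] by auto
qed

text \<open>Setting one argument to 0 writes \<open>A\<close> and \<open>B\<close> as constants
  minus \<open>C\<close>, which makes \<open>C 0 - C x\<close> additive. With this sign,
  \<open>d\<close> is the slope of \<open>A\<close> and \<open>B\<close>.\<close>

lemma pexider:
  fixes A B C :: "'p::prime_card mod_ring \<Rightarrow> 'p mod_ring"
  assumes "\<And>x y. A x + B y + C (x + y) = e"
  obtains a b d where "\<And>x. A x = a + d * x" "\<And>x. B x = b + d * x"
    "\<And>x. C x = e - a - b - d * x"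
proof -
  define h where "h x = C 0 - C x" for x
  have AB: "A x = e - B 0 - C x" "B x = e - A 0 - C x" for x
    using assms[of x 0] assms[of 0 x] by (auto simp: algebra_simps)
  have C0: "C 0 = e - A 0 - B 0" using assms[of 0 0] by (simp add: algebra_simps)
  have "h (x + y) = h x + h y" for x y
  proof -
    have "C (x + y) = e - A x - B y" using assms[of x y] by (simp add: algebra_simps)
    then show ?thesis unfolding h_def C0 AB(1)[of x] AB(2)[of y] by simp
  qed
  from additive_mod_ring[of h, OF this] have h: "C x = C 0 - h 1 * x" for x
    by (metis h_def diff_diff_eq2 add_diff_cancel_left')
  with C0 have C: "C x = e - A 0 - B 0 - h 1 * x" for x by metis
  show thesis
  proof (rule that)
    show "A x = A 0 + h 1 * x" "B x = B 0 + h 1 * x" "C x = e - A 0 - B 0 - h 1 * x" for x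
      unfolding AB[of x] C[of x] by simp_all
  qed
qed

section \<open>Recovering the set from three special directions\<close>

lemma AGL2_preimage:
  fixes M :: "'p::prime_card mod_ring ^ 2 ^ 2"
  assumes "invertible M" and T: "T = {q. M *v q + b \<in> S}"
  shows "\<exists>\<alpha> \<in> AGL2. T = \<alpha> ` S"
proof -
  obtain M' where M': "M ** M' = mat 1" "M' ** M = mat 1"
    using assms(1) by (auto simp: invertible_def)
  \<comment> \<open>The inverse map, \<open>y\<close> to \<open>M' (y - b)\<close>, expanded into
    the shape that \<open>AGL2\<close> demands.\<close>
  let ?\<alpha> = "\<lambda>y. M' *v y + M' *v (- b)"
  have inv: "?\<alpha> (M *v q + b) = q" "M *v ?\<alpha> y + b = y" for q y
  proof -
    have "?\<alpha> y = M' *v (y - b)" for y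
      by (simp flip: matrix_vector_right_distrib)
    then show "?\<alpha> (M *v q + b) = q" "M *v ?\<alpha> y + b = y"
      by (simp_all add: matrix_vector_mul_assoc M')
  qed
  have "invertible M'" using M' by (auto simp: invertible_def)
  then have "?\<alpha> \<in> AGL2" by (auto simp: AGL2_def)
  moreover have "T = ?\<alpha> ` S"
  proof (intro equalityI subsetI)
    fix q assume "q \<in> T"
    then show "q \<in> ?\<alpha> ` S" using inv(1)[of q] unfolding T by (intro image_eqI[of _ _ "M *v q + b"]) auto
  next
    fix q assume "q \<in> ?\<alpha> ` S"
    then show "q \<in> T" unfolding T using inv(2) by auto
  qed
  ultimately show ?thesis by blast
qed

text \<open>With \<open>x = det2 u q\<close> and \<open>y = det2 v q\<close> as coordinates of
  \<open>q\<close>, the third line through \<open>q\<close> has index \<open>x + y\<close>, which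
  gives the counting identity its Pexider form.\<close>

lemma three_special_directions:
  fixes T :: "'p::prime_card plane set"
  assumes uv: "det2 u v \<noteq> 0"
    and counts: "\<And>q. line_count T u (det2 u q) + line_count T v (det2 v q)
        + line_count T (u + v) (det2 (u + v) q) = CARD('p) - 1 + CARD('p) * of_bool (q \<in> T)"
    and card: "2 * card T = CARD('p) * (CARD('p) - 1)"
    and special: "\<nexists>k. \<forall>s. line_count T u s = k" "\<nexists>k. \<forall>s. line_count T v s = k"
      "\<nexists>k. \<forall>s. line_count T (u + v) s = k"
  shows "\<exists>\<alpha> \<in> AGL2. T = \<alpha> ` S_set"
proof -
  let ?A = "line_count T u" and ?B = "line_count T v" and ?C = "line_count T (u + v)"
  let ?r = "to_int_mod_ring :: 'p mod_ring \<Rightarrow> int"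
  have nz: "u \<noteq> 0" "v \<noteq> 0" "u + v \<noteq> 0"
    using uv by (auto simp: det2_def add_eq_0_iff)
  have p: "CARD('p) > 1" by (rule nontriv)
  have eq: "(of_nat (?A x) + of_nat (?B y) + of_nat (?C (x + y)) :: 'p mod_ring) = - 1" for x y
  proof -
    \<comment> \<open>The point with prescribed coordinates \<open>x\<close>, \<open>y\<close>, by
      Cramer's rule.\<close>
    let ?q = "(x / det2 u v) *s v - (y / det2 u v) *s u"
    have q: "det2 u ?q = x" "det2 v ?q = y"
      using uv by (simp_all add: det2_diff_right det2_scale_right det2_self det2_swap[of v u])
    have "(of_nat (?A x + ?B y + ?C (x + y)) :: 'p mod_ring) =
        of_nat (CARD('p) - 1 + CARD('p) * of_bool (?q \<in> T))"
      using counts[of ?q] by (simp only: det2_add_left q)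
    then show ?thesis using p by (simp add: of_nat_diff)
  qed
  obtain a b d :: "'p mod_ring" where mods: "\<And>x. of_nat (?A x) = a + d * x"
      "\<And>x. of_nat (?B x) = b + d * x" "\<And>x. of_nat (?C x) = - 1 - a - b - d * x"
    by (rule pexider[of "\<lambda>x. of_nat (?A x)" "\<lambda>x. of_nat (?B x)" "\<lambda>x. of_nat (?C x)", OF eq])
      (rule that; assumption)
  have d: "d \<noteq> 0"
  proof
    assume "d = 0"
    \<comment> \<open>All three residues are constant, hence 0 by non-constancy of the counts, yet
      they sum to \<open>- 1\<close>.\<close>
    then have "a = 0" "b = 0" "- 1 - a - b = 0"
      using constant_mod_counts_eq_0[of ?A a, OF _ line_count_le[OF nz(1)] special(1)]
        constant_mod_counts_eq_0[of ?B b, OF _ line_count_le[OF nz(2)] special(2)]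
        constant_mod_counts_eq_0[of ?C "- 1 - a - b", OF _ line_count_le[OF nz(3)] special(3)] mods
      by simp_all
    then show False by simp
  qed
  have sum: "2 * (\<Sum>s\<in>UNIV. line_count T w s) = CARD('p) * (CARD('p) - 1)" for w
    using card by (simp add: sum_line_count)
  have reps: "int (?A s) = ?r (a + d * s)" "int (?B s) = ?r (b + d * s)"
      "int (?C s) = int CARD('p) - 1 - ?r (a + b + d * s)" for s
  proof -
    show "int (?A s) = ?r (a + d * s)" "int (?B s) = ?r (b + d * s)"
      using affine_mod_counts_eq mods(1,2) d sum by blast+
    \<comment> \<open>The slope \<open>- d\<close> is nonzero too; reflecting by
      \<open>- 1 - z\<close> then expresses the third count through the representative of
      \<open>a + b + d * s\<close>.\<close>
    have "int (?C s) = ?r (- 1 - a - b + (- d) * s)"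
      by (rule affine_mod_counts_eq) (use mods d sum in simp_all)
    also have "- 1 - a - b + (- d) * s = - 1 - (a + b + d * s)" by simp
    finally show "int (?C s) = int CARD('p) - 1 - ?r (a + b + d * s)"
      by (simp only: to_int_mod_ring_minus_1_minus)
  qed
  let ?X = "\<lambda>q. a + d * det2 u q" and ?Y = "\<lambda>q. b + d * det2 v q"
  have mem: "q \<in> T \<longleftrightarrow> ?r (?X q + ?Y q) < ?r (?X q)" for q
  proof -
    have "int (?A (det2 u q)) + int (?B (det2 v q)) + int (?C (det2 u q + det2 v q))
        = int (CARD('p) - 1 + CARD('p) * of_bool (q \<in> T))"
      using counts[of q] by (simp only: det2_add_left flip: of_nat_add)
    moreover have "a + b + d * (det2 u q + det2 v q) = ?X q + ?Y q" by (simp add: algebra_simps)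
    ultimately have "?r (?X q) + ?r (?Y q) - ?r (?X q + ?Y q) = int CARD('p) * of_bool (q \<in> T)"
      using p by (simp add: reps of_nat_diff)
    \<comment> \<open>The representative of \<open>X + Y\<close> minus that of \<open>X\<close> is
      that of \<open>Y\<close>, less \<open>p\<close> exactly when \<open>q\<close> is in
      \<open>T\<close>. Since representatives lie in \<open>0, ..., p - 1\<close>, its sign decides
      membership.\<close>
    then show ?thesis
      using to_int_mod_ring_bounds[of "?Y q"] by (cases "q \<in> T") simp_all
  qed
  \<comment> \<open>The rows are the linear parts of \<open>X\<close> and \<open>X + Y\<close>, in
    this order because \<open>S_set\<close> asks for the second coordinate to be smaller.\<close>
  let ?M = "vector [vector [- d * u $ 2, d * u $ 1],
      vector [- d * u $ 2 - d * v $ 2, d * u $ 1 + d * v $ 1]] :: 'p mod_ring ^ 2 ^ 2"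
  let ?b = "vector [a, a + b] :: 'p plane"
  have "det ?M = d * d * det2 u v" by (simp add: det_2 det2_def algebra_simps)
  then have "invertible ?M" using d uv by (simp add: invertible_det_nz)
  moreover have M: "(?M *v q + ?b) $ 1 = ?X q" "(?M *v q + ?b) $ 2 = ?X q + ?Y q" for q
    by (simp_all add: matrix_vector_mult_def sum_2 det2_def algebra_simps)
  have "T = {q. ?M *v q + ?b \<in> S_set}"
    by (simp only: set_eq_iff mem_Collect_eq S_set_def mem M) simp
  ultimately show ?thesis by (rule AGL2_preimage)
qed

section \<open>Normalizing the three directions, and the two cardinalities\<close>

lemma AGL2_image_S_set:
  fixes T :: "'p::prime_card plane set"
  assumes eq: "card {D \<in> directions. equidistributed T D} = CARD('p) - 2"
    and card: "2 * card T = CARD('p) * (CARD('p) - 1)"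
  shows "\<exists>\<alpha> \<in> AGL2. T = \<alpha> ` S_set"
proof -
  let ?E = "{D \<in> directions. equidistributed T D}"
  let ?N = "{D \<in> directions. \<not> equidistributed T D}"
  have p: "CARD('p) > 1" by (rule nontriv)
  have split: "directions = ?E \<union> ?N" "?E \<inter> ?N = {}" by auto
  have "card (directions :: 'p plane set set) = card ?E + card ?N"
    using card_Un_disjoint[of ?E ?N] split by simp
  then have "card ?E + card ?N = CARD('p) + 1" unfolding card_directions by simp
  \<comment> \<open>From \<open>(p + 1) - (p - 2)\<close>; truncation is harmless as
    \<open>p\<close> is at least 2.\<close>
  then have "card ?N = 3" using eq p by simp
  then obtain D1 D2 D3 where N: "?N = {D1, D2, D3}" "D1 \<noteq> D2" "D2 \<noteq> D3" "D1 \<noteq> D3"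
    by (auto simp: card_3_iff)
  have rep: "\<exists>v. v \<noteq> 0 \<and> D = proportional `` {v} \<and> (\<nexists>k. \<forall>s. line_count T v s = k)"
    if "D \<in> ?N" for D
  proof -
    from that obtain v where v: "v \<noteq> 0" "D = proportional `` {v}"
      by (auto simp: directions_def elim!: quotientE)
    with that show ?thesis using equidistributed_iff[OF v(1), of T] by blast
  qed
  obtain u v w where
    u: "u \<noteq> 0" "D1 = proportional `` {u}" and
    v: "v \<noteq> 0" "D2 = proportional `` {v}" and
    w: "w \<noteq> 0" "D3 = proportional `` {w}" "\<nexists>k. \<forall>s. line_count T w s = k"
    using rep[of D1] rep[of D2] rep[of D3] unfolding N by blast
  have indep: "det2 x y \<noteq> 0"
    if xy: "x \<noteq> 0" "y \<noteq> 0" "proportional `` {x} \<noteq> proportional `` {y}" for x y :: "'p plane"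
  proof
    assume "det2 x y = 0"
    then obtain c where "y = c *s x" using det2_eq_0_iff[OF xy(1)] by blast
    then have "(x, y) \<in> proportional" using xy by (auto simp: proportional_def vec_eq_iff)
    then show False using equiv_class_eq[OF equiv_proportional] xy(3) by blast
  qed
  have uv: "det2 u v \<noteq> 0" and vw: "det2 v w \<noteq> 0" and uw: "det2 u w \<noteq> 0"
    using indep u v w N by auto
  \<comment> \<open>The coefficients of \<open>w\<close> in the basis \<open>u\<close>,
    \<open>v\<close>. They are nonzero because the three directions are distinct, so
    \<open>u'\<close> and \<open>v'\<close> still represent \<open>D1\<close> and
    \<open>D2\<close>.\<close>
  define u' where "u' = (- det2 v w / det2 u v) *s u"
  define v' where "v' = (det2 u w / det2 u v) *s v"
  have w': "w = u' + v'"
  proof -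
    have "w = (1 / det2 u v) *s (det2 u v *s w)" using uv by (simp add: vector_smult_assoc)
    also have "\<dots> = u' + v'"
      unfolding det2_cramer[of u v w] by (simp add: vec2_eq_iff u'_def v'_def diff_divide_distrib)
    finally show ?thesis .
  qed
  have scaled: "c *s x \<noteq> 0" "proportional `` {c *s x} = proportional `` {x}"
    if "x \<noteq> 0" "c \<noteq> 0" for c and x :: "'p plane"
  proof -
    show "c *s x \<noteq> 0" using that by (auto simp: vec_eq_iff)
    then have "(x, c *s x) \<in> proportional" using that by (auto simp: proportional_def)
    from equiv_class_eq[OF equiv_proportional this]
    show "proportional `` {c *s x} = proportional `` {x}" by simp
  qed
  have u': "u' \<noteq> 0" "D1 = proportional `` {u'}" and v': "v' \<noteq> 0" "D2 = proportional `` {v'}"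
    using scaled[OF u(1), of "- det2 v w / det2 u v"] scaled[OF v(1), of "det2 u w / det2 u v"]
      u(2) v(2) uv vw uw by (simp_all only: u'_def v'_def) simp_all
  show ?thesis
  proof (rule three_special_directions)
    show "det2 u' v' \<noteq> 0" using indep u' v' N by blast
    show "2 * card T = CARD('p) * (CARD('p) - 1)" by fact
    show "\<nexists>k. \<forall>s. line_count T u' s = k" "\<nexists>k. \<forall>s. line_count T v' s = k"
      using equidistributed_iff[OF u'(1), of T] equidistributed_iff[OF v'(1), of T] N(1) u'(2) v'(2)
      by blast+
    show "\<nexists>k. \<forall>s. line_count T (u' + v') s = k" using w w' by simp
    fix q
    let ?c = "line_count T u' (det2 u' q) + line_count T v' (det2 v' q)
        + line_count T (u' + v') (det2 (u' + v') q)"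
    \<comment> \<open>The \<open>p\<close> parallel lines share \<open>T\<close> equally.\<close>
    have "CARD('p) * count_through T q D = card T" if D: "D \<in> ?E" for D
    proof -
      from D obtain x where x: "x \<noteq> 0" "D = proportional `` {x}"
        by (auto simp: directions_def elim!: quotientE)
      with D obtain k where k: "line_count T x s = k" for s
        using equidistributed_iff[OF x(1), of T] by blast
      then show ?thesis
        using sum_line_count[of T x] count_through_class[OF x(1), of T q] x(2) by simp
    qed
    then have E: "CARD('p) * (\<Sum>D\<in>?E. count_through T q D) = (CARD('p) - 2) * card T"
      by (simp add: sum_distrib_left eq)
    have "(\<Sum>D\<in>?N. count_through T q D) = ?c"
      unfolding N using N(2-4) u' v' w w' by (simp add: count_through_class)
    then have total: "(\<Sum>D\<in>?E. count_through T q D) + ?c = card T + CARD('p) * of_bool (q \<in> T)"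
      using sum.union_disjoint[of ?E ?N "count_through T q"] split sum_count_through[of T q] by simp
    \<comment> \<open>Everything is multiplied by \<open>p\<close> to keep \<open>card T / p\<close>
      within the natural numbers; \<open>p\<close> is cancelled at the end.\<close>
    have "(CARD('p) - 2) * card T + CARD('p) * ?c
        = CARD('p) * ((\<Sum>D\<in>?E. count_through T q D) + ?c)"
      using E by (simp only: distrib_left)
    then have "(CARD('p) - 2) * card T + CARD('p) * ?c
        = CARD('p) * (card T + CARD('p) * of_bool (q \<in> T))"
      by (simp only: total)
    moreover have "CARD('p) * card T = (CARD('p) - 2) * card T + 2 * card T"
    proof -
      have "CARD('p) - 2 + 2 = CARD('p)" using p by simp
      then show ?thesis by (metis distrib_right)
    qed
    ultimately have "CARD('p) * ?c = 2 * card T + CARD('p) * (CARD('p) * of_bool (q \<in> T))"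
      by (simp add: distrib_left)
    also have "\<dots> = CARD('p) * (CARD('p) - 1 + CARD('p) * of_bool (q \<in> T))"
      by (simp only: card distrib_left)
    finally show "?c = CARD('p) - 1 + CARD('p) * of_bool (q \<in> T)"
      using p by (subst (asm) mult_cancel1) simp
  qed
qed

theorem theorem4p1:
  fixes T :: "'p::prime_card plane set"
  assumes "card {D \<in> directions. equidistributed T D} = CARD('p) - 2"
  shows "(card T = CARD('p) * (CARD('p) - 1) div 2 \<longrightarrow> (\<exists>\<alpha> \<in> AGL2. T = \<alpha> ` S_set)) \<and>
         (card T = CARD('p) * (CARD('p) + 1) div 2 \<longrightarrow> (\<exists>\<alpha>' \<in> AGL2. T = \<alpha>' ` (- S_set)))"
proof (intro conjI impI)
  assume "card T = CARD('p) * (CARD('p) - 1) div 2"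
  then have "2 * card T = CARD('p) * (CARD('p) - 1)" by simp
  then show "\<exists>\<alpha> \<in> AGL2. T = \<alpha> ` S_set" by (rule AGL2_image_S_set[OF assms])
next
  have p: "CARD('p) > 1" by (rule nontriv)
  assume "card T = CARD('p) * (CARD('p) + 1) div 2"
  then have "2 * card T = CARD('p) * (CARD('p) + 1)" by simp
  moreover have "card T + card (- T) = CARD('p)^2"
    using card_Un_disjoint[of T "- T"] by simp
  ultimately have "2 * card (- T) + CARD('p) * (CARD('p) + 1) = 2 * CARD('p)^2" by simp
  moreover have "CARD('p) * (CARD('p) - 1) + CARD('p) * (CARD('p) + 1) = 2 * CARD('p)^2"
    using p by (cases "CARD('p)") (simp_all add: power2_eq_square)
  ultimately have card: "2 * card (- T) = CARD('p) * (CARD('p) - 1)" by linarith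
  \<comment> \<open>Complementing twice yields the reverse inclusion.\<close>
  have "{D \<in> directions. equidistributed (- T) D} = {D \<in> directions. equidistributed T D}"
    using equidistributed_Compl[of _ T] equidistributed_Compl[of _ "- T"] by auto
  with assms have "card {D \<in> directions. equidistributed (- T) D} = CARD('p) - 2" by simp
  from AGL2_image_S_set[OF this card] obtain \<alpha> where \<alpha>: "\<alpha> \<in> AGL2" "- T = \<alpha> ` S_set" by blast
  \<comment> \<open>Bijectivity lets the image commute with complements, which turns
    \<open>- T\<close> back into \<open>T\<close>.\<close>
  have "bij \<alpha>"
  proof -
    from \<alpha>(1) obtain M b where "\<alpha> = (\<lambda>x. x + b) \<circ> (*v) M" "invertible M"
      by (auto simp: AGL2_def o_def)
    moreover have "bij (\<lambda>x :: 'p plane. x + b)"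
      by (rule bij_betw_byWitness[where f'="\<lambda>x. x - b"]) auto
    ultimately show ?thesis by (simp only: invertible_eq_bij bij_comp)
  qed
  then have "T = \<alpha> ` (- S_set)" using \<alpha>(2) by (simp add: bij_image_Compl_eq flip: \<alpha>(2))
  with \<alpha>(1) show "\<exists>\<alpha>' \<in> AGL2. T = \<alpha>' ` (- S_set)" by blast
qed

end
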